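(* Let $R$ be a zero-symmetric right near-ring, $M$ a faithful left $R$-module, and $v\in\{0,2,3,c\}$. If $P$ is a $v$-prime $R$-ideal of $M$, then $P$ is a $v$-classical prime $R$-ideal of $M$.
   Context: A right near-ring $(R,+,\cdot)$ is a (not necessarily abelian) group $(R,+)$ with an associative multiplication satisfying $(a+b)c=ac+bc$ (no identity assumed); it is zero-symmetric if $r0=0r=0$ for all $r$. A left $R$-module $M$ is a (not necessarily abelian) group $(M,+)$ with an action $R\times M\to M$ satisfying $(r_1+r_2)m=r_1m+r_2m$ and $(r_1r_2)m=r_1(r_2m)$. $M$ is faithful if $rM=0$ implies $r=0$. An $R$-submodule of $M$ is a subgroup $H$ with $RH\subseteq H$; an $R$-ideal of $M$ is a normal subgroup $P$ of $(M,+)$ with $r(m+n)-rm\in P$ for all $r\in R$, $m\in M$, $n\in P$. A left $R$-subgroup of $R$ is a subgroup $H$ of $(R,+)$ with $RH\subseteq H$. An ideal of $R$ is a normal subgroup $I$ of $(R,+)$ with $IR\subseteq I$ and $r_1(r_2+i)-r_1r_2\in I$ for all $r_1,r_2\in R$, $i\in I$. Products of subsets are elementwise, e.g. $RH=\{rh: r\in R,h\in H\}$. For an $R$-ideal $P$ of $M$ with $RM\nsubseteq P$, $P$ is called: - $0$-prime if for all ideals $A$ of $R$ and all $R$-submodules $B$ of $M$, $AB\subseteq P$ implies $AM\subseteq P$ or $B\subseteq P$; - $2$-prime if the same holds for all left $R$-subgroups $A$ of $R$ and all $R$-submodules $B$ of $M$; - $3$-prime if for all $a\in R$, $m\in M$,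 $aRm\subseteq P$ implies $aM\subseteq P$ or $m\in P$; - $c$-prime if for all $r\in R$, $m\in M$, $rm\in P$ implies $rM\subseteq P$ or $m\in P$. For an $R$-ideal $P$ of $M$ with $RM\nsubseteq P$, $P$ is called: - $0$-classical prime if for all ideals $A,B$ of $R$ and all $R$-submodules $N$ of $M$, $ABN\subseteq P$ implies $AN\subseteq P$ or $BN\subseteq P$; - $2$-classical prime if the same holds for all left $R$-subgroups $A,B$ of $R$ and all $R$-submodules $N$ of $M$; - $3$-classical prime if for all $a,b\in R$ and all $R$-submodules $N$ of $M$, $(aR)(bR)N\subseteq P$ implies $aN\subseteq P$ or $bN\subseteq P$; - $c$-classical prime if for all $a,b\in R$ and all $R$-submodules $N$ of $M$, $(aRb)N\subseteq P$ implies $aN\subseteq P$ or $bN\subseteq P$. *)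

theory Defs
  imports "HOL-Algebra.AbelCoset" "HOL-Algebra.Module"
begin

(* Near-rings and their modules live on the library records for rings and modules.  A near-ring
   has no identity, so the field one of the record R is unconstrained; likewise the fields mult
   and one of the record M, of which only the additive part and smult matter.  Addition is not
   assumed commutative: x \<ominus>\<^bsub>M\<^esub> y is x \<oplus>\<^bsub>M\<^esub> (\<ominus>\<^bsub>M\<^esub> y), in this order. *)

locale right_near_ring =
  fixes R (structure)
  assumes add_group: "group (add_monoid R)"
    and mult_closed: "\<lbrakk>a \<in> carrier R; b \<in> carrier R\<rbrakk> \<Longrightarrow> a \<otimes> b \<in> carrier R"
    and mult_assoc: "\<lbrakk>a \<in> carrier R; b \<in> carrier R; c \<in> carrier R\<rbrakk>
      \<Longrightarrow> (a \<otimes> b) \<otimes> c = a \<otimes> (b \<otimes> c)"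
    and right_distrib: "\<lbrakk>a \<in> carrier R; b \<in> carrier R; c \<in> carrier R\<rbrakk>
      \<Longrightarrow> (a \<oplus> b) \<otimes> c = (a \<otimes> c) \<oplus> (b \<otimes> c)"

locale zero_symmetric_near_ring = right_near_ring +
  assumes zero_symmetric: "r \<in> carrier R \<Longrightarrow> r \<otimes> \<zero> = \<zero> \<and> \<zero> \<otimes> r = \<zero>"

(* The action need not distribute over the addition of M. *)
locale near_ring_module = right_near_ring R for R (structure) +
  fixes M :: "('a, 'b, 'c) module_scheme" (structure)
  assumes module_add_group: "group (add_monoid M)"
    and smult_closed: "\<lbrakk>r \<in> carrier R; m \<in> carrier M\<rbrakk> \<Longrightarrow> r \<odot>\<^bsub>M\<^esub> m \<in> carrier M"
    and smult_distrib: "\<lbrakk>r \<in> carrier R; s \<in> carrier R; m \<in> carrier M\<rbrakk>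
      \<Longrightarrow> (r \<oplus>\<^bsub>R\<^esub> s) \<odot>\<^bsub>M\<^esub> m = (r \<odot>\<^bsub>M\<^esub> m) \<oplus>\<^bsub>M\<^esub> (s \<odot>\<^bsub>M\<^esub> m)"
    and smult_assoc: "\<lbrakk>r \<in> carrier R; s \<in> carrier R; m \<in> carrier M\<rbrakk>
      \<Longrightarrow> (r \<otimes>\<^bsub>R\<^esub> s) \<odot>\<^bsub>M\<^esub> m = r \<odot>\<^bsub>M\<^esub> (s \<odot>\<^bsub>M\<^esub> m)"

(* Elementwise product, not a generated subgroup; the analogue of set_mult (written A <#> B). *)
definition set_smult ::
    "('a, 'b, 'c) module_scheme \<Rightarrow> 'a set \<Rightarrow> 'b set \<Rightarrow> 'b set"
  where "set_smult M A N = (\<Union>r\<in>A. \<Union>m\<in>N. {r \<odot>\<^bsub>M\<^esub> m})"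

definition faithful_module where
  "faithful_module R M \<longleftrightarrow>
    (\<forall>r\<in>carrier R. set_smult M {r} (carrier M) = {\<zero>\<^bsub>M\<^esub>} \<longrightarrow> r = \<zero>\<^bsub>R\<^esub>)"

definition R_submodule where
  "R_submodule R M H \<longleftrightarrow> additive_subgroup H M \<and> set_smult M (carrier R) H \<subseteq> H"

definition R_ideal where
  "R_ideal R M P \<longleftrightarrow> P \<lhd> add_monoid M \<and>
    (\<forall>r\<in>carrier R. \<forall>m\<in>carrier M. \<forall>n\<in>P.
      (r \<odot>\<^bsub>M\<^esub> (m \<oplus>\<^bsub>M\<^esub> n)) \<ominus>\<^bsub>M\<^esub> (r \<odot>\<^bsub>M\<^esub> m) \<in> P)"

definition left_R_subgroup where
  "left_R_subgroup R H \<longleftrightarrow> additive_subgroup H R \<and> carrier R <#>\<^bsub>R\<^esub> H \<subseteq> H"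

definition near_ring_ideal where
  "near_ring_ideal R I \<longleftrightarrow> I \<lhd> add_monoid R \<and> I <#>\<^bsub>R\<^esub> carrier R \<subseteq> I \<and>
    (\<forall>r\<in>carrier R. \<forall>s\<in>carrier R. \<forall>i\<in>I.
      (r \<otimes>\<^bsub>R\<^esub> (s \<oplus>\<^bsub>R\<^esub> i)) \<ominus>\<^bsub>R\<^esub> (r \<otimes>\<^bsub>R\<^esub> s) \<in> I)"

definition proper_R_ideal where
  "proper_R_ideal R M P \<longleftrightarrow>
    R_ideal R M P \<and> \<not> set_smult M (carrier R) (carrier M) \<subseteq> P"

definition prime_0 where
  "prime_0 R M P \<longleftrightarrow> proper_R_ideal R M P \<and>
    (\<forall>A B. near_ring_ideal R A \<longrightarrow> R_submodule R M B \<longrightarrow> set_smult M A B \<subseteq> P \<longrightarrow>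
      set_smult M A (carrier M) \<subseteq> P \<or> B \<subseteq> P)"

definition prime_2 where
  "prime_2 R M P \<longleftrightarrow> proper_R_ideal R M P \<and>
    (\<forall>A B. left_R_subgroup R A \<longrightarrow> R_submodule R M B \<longrightarrow> set_smult M A B \<subseteq> P \<longrightarrow>
      set_smult M A (carrier M) \<subseteq> P \<or> B \<subseteq> P)"

definition prime_3 where
  "prime_3 R M P \<longleftrightarrow> proper_R_ideal R M P \<and>
    (\<forall>a\<in>carrier R. \<forall>m\<in>carrier M. set_smult M (a <#\<^bsub>R\<^esub> carrier R) {m} \<subseteq> P \<longrightarrow>
      set_smult M {a} (carrier M) \<subseteq> P \<or> m \<in> P)"

definition prime_c where
  "prime_c R M P \<longleftrightarrow> proper_R_ideal R M P \<and>
    (\<forall>r\<in>carrier R. \<forall>m\<in>carrier M. r \<odot>\<^bsub>M\<^esub> m \<in> P \<longrightarrow>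
      set_smult M {r} (carrier M) \<subseteq> P \<or> m \<in> P)"

definition classical_prime_0 where
  "classical_prime_0 R M P \<longleftrightarrow> proper_R_ideal R M P \<and>
    (\<forall>A B N. near_ring_ideal R A \<longrightarrow> near_ring_ideal R B \<longrightarrow> R_submodule R M N \<longrightarrow>
      set_smult M (A <#>\<^bsub>R\<^esub> B) N \<subseteq> P \<longrightarrow>
      set_smult M A N \<subseteq> P \<or> set_smult M B N \<subseteq> P)"

definition classical_prime_2 where
  "classical_prime_2 R M P \<longleftrightarrow> proper_R_ideal R M P \<and>
    (\<forall>A B N. left_R_subgroup R A \<longrightarrow> left_R_subgroup R B \<longrightarrow> R_submodule R M N \<longrightarrow>
      set_smult M (A <#>\<^bsub>R\<^esub> B) N \<subseteq> P \<longrightarrow>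
      set_smult M A N \<subseteq> P \<or> set_smult M B N \<subseteq> P)"

definition classical_prime_3 where
  "classical_prime_3 R M P \<longleftrightarrow> proper_R_ideal R M P \<and>
    (\<forall>a\<in>carrier R. \<forall>b\<in>carrier R. \<forall>N. R_submodule R M N \<longrightarrow>
      set_smult M ((a <#\<^bsub>R\<^esub> carrier R) <#>\<^bsub>R\<^esub> (b <#\<^bsub>R\<^esub> carrier R)) N \<subseteq> P \<longrightarrow>
      set_smult M {a} N \<subseteq> P \<or> set_smult M {b} N \<subseteq> P)"

definition classical_prime_c where
  "classical_prime_c R M P \<longleftrightarrow> proper_R_ideal R M P \<and>
    (\<forall>a\<in>carrier R. \<forall>b\<in>carrier R. \<forall>N. R_submodule R M N \<longrightarrow>
      set_smult M ((a <#\<^bsub>R\<^esub> carrier R) #>\<^bsub>R\<^esub> b) N \<subseteq> P \<longrightarrow>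
      set_smult M {a} N \<subseteq> P \<or> set_smult M {b} N \<subseteq> P)"

end

theory Submission
  imports Defs
begin

text \<open>
  Associativity turns an inclusion of \<open>(AB)N\<close> in \<open>P\<close> into one of \<open>A(BN)\<close>, to which
  primeness of \<open>P\<close> applies: either \<open>A\<close> sends all of \<open>M\<close>, and so \<open>N\<close>, into \<open>P\<close>, or
  \<open>BN \<subseteq> P\<close>.

  For the variants \<open>0\<close> and \<open>2\<close> the obstacle is that the elementwise product \<open>BN\<close> need not be
  a subgroup of \<open>M\<close>.  But the action distributes over the addition of \<open>R\<close>, so for a single
  \<open>n\<close> the set \<open>Bn\<close> is an \<open>R\<close>-submodule (lemma \<open>R_submodule_orbit\<close>), and \<open>BN\<close> is the union of
  these sets.  Since the first alternative of primeness, \<open>AM \<subseteq> P\<close>, does not involve \<open>n\<close>,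
  treating the elements of \<open>N\<close> one at a time loses nothing.  Zero-symmetry turns ideals of
  the near-ring into left \<open>R\<close>-subgroups, so one argument covers both variants (lemma
  \<open>product_into_R_ideal\<close>).

  For the variants \<open>3\<close> and \<open>c\<close> the hypothesis carries extra factors \<open>R\<close>, and a second
  use of primeness removes them.  For \<open>3\<close>, that second use may end in \<open>N \<subseteq> P\<close>;
  then \<open>aN \<subseteq> P\<close>, because zero-symmetry makes \<open>P\<close> closed under the action
  (lemma \<open>R_ideal_smult_closed\<close>).  For \<open>c\<close>, the second use cancels a scalar \<open>r\<close>
  with \<open>rM \<not>\<subseteq> P\<close>, which exists because \<open>P\<close> is proper.
\<close>

section \<open>The action of a near-ring\<close>

lemma set_smult_subset_iff:
  "set_smult M A N \<subseteq> P \<longleftrightarrow> (\<forall>a\<in>A. \<forall>n\<in>N. a \<odot>\<^bsub>M\<^esub> n \<in> P)"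
  by (auto simp: set_smult_def)

lemma R_submodule_subset: "R_submodule R M N \<Longrightarrow> N \<subseteq> carrier M"
  by (simp add: R_submodule_def additive_subgroup.a_subset)

lemma left_R_subgroup_subset: "left_R_subgroup R A \<Longrightarrow> A \<subseteq> carrier R"
  by (simp add: left_R_subgroup_def additive_subgroup.a_subset)

lemma (in near_ring_module) zero_smult:
  assumes "m \<in> carrier M"
  shows "\<zero> \<odot>\<^bsub>M\<^esub> m = \<zero>\<^bsub>M\<^esub>"
proof -
  interpret RG: group "add_monoid R" by (rule add_group)
  interpret MG: group "add_monoid M" by (rule module_add_group)
  have zero_closed: "\<zero> \<in> carrier R" using RG.one_closed by simp
  have "\<zero> \<oplus> \<zero> = \<zero>" using RG.l_one[of \<zero>] zero_closed by simp
  then have "(\<zero> \<odot>\<^bsub>M\<^esub> m) \<oplus>\<^bsub>M\<^esub> (\<zero> \<odot>\<^bsub>M\<^esub> m) = \<zero> \<odot>\<^bsub>M\<^esub> m"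
    using smult_distrib[OF zero_closed zero_closed assms] by simp
  then show ?thesis
    using MG.r_cancel_one[of "\<zero> \<odot>\<^bsub>M\<^esub> m" "\<zero> \<odot>\<^bsub>M\<^esub> m"] smult_closed[OF zero_closed assms] by simp
qed

lemma (in near_ring_module) minus_smult:
  assumes "r \<in> carrier R" and "m \<in> carrier M"
  shows "(\<ominus> r) \<odot>\<^bsub>M\<^esub> m = \<ominus>\<^bsub>M\<^esub> (r \<odot>\<^bsub>M\<^esub> m)"
proof -
  interpret RG: group "add_monoid R" by (rule add_group)
  interpret MG: group "add_monoid M" by (rule module_add_group)
  have minus_closed: "\<ominus> r \<in> carrier R"
    using RG.inv_closed assms(1) by (simp add: a_inv_def)
  have "(\<ominus> r) \<oplus> r = \<zero>" using RG.l_inv assms(1) by (simp add: a_inv_def)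
  then have "((\<ominus> r) \<odot>\<^bsub>M\<^esub> m) \<oplus>\<^bsub>M\<^esub> (r \<odot>\<^bsub>M\<^esub> m) = \<zero>\<^bsub>M\<^esub>"
    using smult_distrib[OF minus_closed assms] zero_smult[OF assms(2)] by simp
  then have "inv\<^bsub>add_monoid M\<^esub> (r \<odot>\<^bsub>M\<^esub> m) = (\<ominus> r) \<odot>\<^bsub>M\<^esub> m"
    using MG.inv_equality smult_closed[OF assms] smult_closed[OF minus_closed assms(2)] by simp
  then show ?thesis by (simp add: a_inv_def)
qed

text \<open>
  Additivity of the action in the scalar makes the orbit \<open>Bn\<close> of a single element a subgroup.
  A sum \<open>bn + b'n'\<close> with \<open>n \<noteq> n'\<close> need not be a product, which is why \<open>n\<close> is fixed.
\<close>

lemma (in near_ring_module) R_submodule_orbit: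
  assumes B: "left_R_subgroup R B" and n: "n \<in> carrier M"
  shows "R_submodule R M (set_smult M B {n})"
proof -
  interpret RG: group "add_monoid R" by (rule add_group)
  interpret MG: group "add_monoid M" by (rule module_add_group)
  interpret B: additive_subgroup B R using B by (simp add: left_R_subgroup_def)
  note B_sub = subsetD[OF left_R_subgroup_subset[OF B]]
  have orbit: "set_smult M B {n} = (\<lambda>b. b \<odot>\<^bsub>M\<^esub> n) ` B" by (auto simp: set_smult_def)
  have "subgroup (set_smult M B {n}) (add_monoid M)"
  proof (rule MG.subgroupI)
    show "set_smult M B {n} \<subseteq> carrier (add_monoid M)"
      using smult_closed n B_sub by (auto simp: orbit)
    show "set_smult M B {n} \<noteq> {}"
      unfolding orbit using subgroup.one_closed[OF B.a_subgroup] by blast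
    show "inv\<^bsub>add_monoid M\<^esub> x \<in> set_smult M B {n}" if x: "x \<in> set_smult M B {n}" for x
    proof -
      obtain b where b: "b \<in> B" "x = b \<odot>\<^bsub>M\<^esub> n" using x by (auto simp: orbit)
      have "\<ominus> b \<in> B"
        using subgroup.m_inv_closed[OF B.a_subgroup b(1)] by (simp add: a_inv_def)
      then have "\<ominus>\<^bsub>M\<^esub> x \<in> set_smult M B {n}"
        using minus_smult[OF B_sub[OF b(1)] n] b(2) by (force simp: orbit)
      then show ?thesis by (simp add: a_inv_def)
    qed
    show "x \<otimes>\<^bsub>add_monoid M\<^esub> y \<in> set_smult M B {n}"
      if xy: "x \<in> set_smult M B {n}" "y \<in> set_smult M B {n}" for x y
    proof -
      obtain b c where b: "b \<in> B" "x = b \<odot>\<^bsub>M\<^esub> n" and c: "c \<in> B" "y = c \<odot>\<^bsub>M\<^esub> n"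
        using xy by (auto simp: orbit)
      have "b \<oplus> c \<in> B" using b c B.a_closed by simp
      moreover have "x \<oplus>\<^bsub>M\<^esub> y = (b \<oplus> c) \<odot>\<^bsub>M\<^esub> n"
        using smult_distrib[OF B_sub B_sub n] b c by simp
      ultimately show ?thesis by (auto simp: orbit)
    qed
  qed
  moreover have "r \<odot>\<^bsub>M\<^esub> (b \<odot>\<^bsub>M\<^esub> n) \<in> set_smult M B {n}"
    if r: "r \<in> carrier R" and b: "b \<in> B" for r b
  proof -
    have "r \<otimes> b \<in> B" using B r b by (auto simp: left_R_subgroup_def set_mult_def)
    then show ?thesis using smult_assoc[OF r B_sub[OF b] n] by (force simp: orbit)
  qed
  then have "set_smult M (carrier R) (set_smult M B {n}) \<subseteq> set_smult M B {n}"
    by (auto simp: set_smult_subset_iff orbit)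
  ultimately show ?thesis by (simp add: R_submodule_def additive_subgroup_def)
qed

section \<open>Consequences of zero-symmetry\<close>

text \<open>
  At \<open>s = \<zero>\<close> the defining condition on \<open>r(s + i) - rs\<close> becomes one on \<open>ri - r\<zero>\<close>, and
  zero-symmetry removes the second term.
\<close>

lemma (in zero_symmetric_near_ring) left_R_subgroup_near_ring_ideal:
  assumes "near_ring_ideal R I"
  shows "left_R_subgroup R I"
proof -
  interpret RG: group "add_monoid R" by (rule add_group)
  have I: "subgroup I (add_monoid R)"
    using assms by (auto simp: near_ring_ideal_def normal_imp_subgroup)
  have zero_closed: "\<zero> \<in> carrier R" using RG.one_closed by simp
  have "r \<otimes> i \<in> I" if r: "r \<in> carrier R" and i: "i \<in> I" for r i
  proof -
    have i_closed: "i \<in> carrier R" using subgroup.subset[OF I] i by auto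
    have "(r \<otimes> (\<zero> \<oplus> i)) \<ominus> (r \<otimes> \<zero>) \<in> I"
      using assms r zero_closed i by (auto simp: near_ring_ideal_def)
    then show ?thesis
      using zero_symmetric[OF r] RG.l_one[of i] i_closed RG.r_one[of "r \<otimes> i"] RG.inv_one
        mult_closed[OF r i_closed] by (simp add: a_minus_def a_inv_def)
  qed
  then show ?thesis
    using I by (auto simp: left_R_subgroup_def additive_subgroup_def set_mult_def)
qed

locale zero_symmetric_module = zero_symmetric_near_ring R + near_ring_module R M
  for R (structure) and M (structure)
begin

lemma smult_zero:
  assumes r: "r \<in> carrier R"
  shows "r \<odot>\<^bsub>M\<^esub> \<zero>\<^bsub>M\<^esub> = \<zero>\<^bsub>M\<^esub>"
proof -
  have closed: "\<zero>\<^bsub>R\<^esub> \<in> carrier R" "\<zero>\<^bsub>M\<^esub> \<in> carrier M"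
    using group.is_monoid[OF add_group] group.is_monoid[OF module_add_group]
    by (auto dest: monoid.one_closed)
  \<comment> \<open>The zero of \<open>M\<close> absorbs scalars because it is itself a multiple of the zero of \<open>R\<close>.\<close>
  have "r \<odot>\<^bsub>M\<^esub> \<zero>\<^bsub>M\<^esub> = r \<odot>\<^bsub>M\<^esub> (\<zero>\<^bsub>R\<^esub> \<odot>\<^bsub>M\<^esub> \<zero>\<^bsub>M\<^esub>)" using zero_smult closed by simp
  also have "\<dots> = (r \<otimes>\<^bsub>R\<^esub> \<zero>\<^bsub>R\<^esub>) \<odot>\<^bsub>M\<^esub> \<zero>\<^bsub>M\<^esub>" using smult_assoc r closed by simp
  also have "\<dots> = \<zero>\<^bsub>M\<^esub>" using zero_symmetric r zero_smult closed by simp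
  finally show ?thesis .
qed

lemma R_ideal_smult_closed:
  assumes P: "R_ideal R M P" and r: "r \<in> carrier R" and p: "p \<in> P"
  shows "r \<odot>\<^bsub>M\<^esub> p \<in> P"
proof -
  interpret MG: group "add_monoid M" by (rule module_add_group)
  have "subgroup P (add_monoid M)" using P by (auto simp: R_ideal_def normal_imp_subgroup)
  then have p_closed: "p \<in> carrier M" using subgroup.subset p by fastforce
  have "\<zero>\<^bsub>M\<^esub> \<in> carrier M" using MG.one_closed by simp
  then have "(r \<odot>\<^bsub>M\<^esub> (\<zero>\<^bsub>M\<^esub> \<oplus>\<^bsub>M\<^esub> p)) \<ominus>\<^bsub>M\<^esub> (r \<odot>\<^bsub>M\<^esub> \<zero>\<^bsub>M\<^esub>) \<in> P"
    using P r p by (auto simp: R_ideal_def)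
  then show ?thesis
    using smult_zero[OF r] MG.l_one[of p] p_closed MG.r_one[of "r \<odot>\<^bsub>M\<^esub> p"] MG.inv_one
      smult_closed[OF r p_closed] by (simp add: a_minus_def a_inv_def)
qed

end

section \<open>Primeness for ideals and left subgroups\<close>

text \<open>
  The common core of the variants \<open>0\<close> and \<open>2\<close>: the hypothesis \<open>prime\<close> is what either notion
  of primeness says about a fixed \<open>A\<close>.
\<close>

lemma (in near_ring_module) product_into_R_ideal:
  assumes A: "A \<subseteq> carrier R" and B: "left_R_subgroup R B" and N: "N \<subseteq> carrier M"
    and prime: "\<And>L. \<lbrakk>R_submodule R M L; set_smult M A L \<subseteq> P\<rbrakk>
      \<Longrightarrow> set_smult M A (carrier M) \<subseteq> P \<or> L \<subseteq> P"
    and ABN: "set_smult M (A <#> B) N \<subseteq> P"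
  shows "set_smult M A N \<subseteq> P \<or> set_smult M B N \<subseteq> P"
proof (cases "set_smult M A (carrier M) \<subseteq> P")
  case True
  then show ?thesis using N by (auto simp: set_smult_subset_iff)
next
  case False
  have "set_smult M B {n} \<subseteq> P" if n: "n \<in> N" for n
  proof -
    have n_closed: "n \<in> carrier M" using n N by auto
    have "a \<odot>\<^bsub>M\<^esub> (b \<odot>\<^bsub>M\<^esub> n) \<in> P" if a: "a \<in> A" and b: "b \<in> B" for a b
    proof -
      have "a \<otimes> b \<in> A <#> B" using a b by (auto simp: set_mult_def)
      then have "(a \<otimes> b) \<odot>\<^bsub>M\<^esub> n \<in> P" using ABN n by (auto simp: set_smult_subset_iff)
      then show ?thesis
        using smult_assoc[OF subsetD[OF A a] subsetD[OF left_R_subgroup_subset[OF B] b] n_closed]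
        by simp
    qed
    then have "set_smult M A (set_smult M B {n}) \<subseteq> P" by (auto simp: set_smult_def)
    then show ?thesis using prime[OF R_submodule_orbit[OF B n_closed]] False by blast
  qed
  then show ?thesis by (auto simp: set_smult_subset_iff)
qed

lemma (in near_ring_module) prime_2_imp_classical_prime_2:
  assumes P: "prime_2 R M P"
  shows "classical_prime_2 R M P"
  unfolding classical_prime_2_def
proof (intro conjI allI impI)
  show "proper_R_ideal R M P" using P by (simp add: prime_2_def)
  fix A B N
  assume A: "left_R_subgroup R A" and B: "left_R_subgroup R B" and N: "R_submodule R M N"
    and ABN: "set_smult M (A <#> B) N \<subseteq> P"
  show "set_smult M A N \<subseteq> P \<or> set_smult M B N \<subseteq> P"
    by (rule product_into_R_ideal[OF left_R_subgroup_subset[OF A] B R_submodule_subset[OF N] _ ABN])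
      (use P A in \<open>auto simp: prime_2_def\<close>)
qed

lemma (in zero_symmetric_module) prime_0_imp_classical_prime_0:
  assumes P: "prime_0 R M P"
  shows "classical_prime_0 R M P"
  unfolding classical_prime_0_def
proof (intro conjI allI impI)
  show "proper_R_ideal R M P" using P by (simp add: prime_0_def)
  fix A B N
  assume A: "near_ring_ideal R A" and B: "near_ring_ideal R B" and N: "R_submodule R M N"
    and ABN: "set_smult M (A <#>\<^bsub>R\<^esub> B) N \<subseteq> P"
  note subgroups = left_R_subgroup_near_ring_ideal[OF A] left_R_subgroup_near_ring_ideal[OF B]
  show "set_smult M A N \<subseteq> P \<or> set_smult M B N \<subseteq> P"
    by (rule product_into_R_ideal[OF left_R_subgroup_subset[OF subgroups(1)] subgroups(2)
          R_submodule_subset[OF N] _ ABN])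
      (use P A in \<open>auto simp: prime_0_def\<close>)
qed

section \<open>Primeness for elements\<close>

lemma (in zero_symmetric_module) prime_3_imp_classical_prime_3:
  assumes P: "prime_3 R M P"
  shows "classical_prime_3 R M P"
  unfolding classical_prime_3_def
proof (intro conjI ballI allI impI)
  show proper: "proper_R_ideal R M P" using P by (simp add: prime_3_def)
  fix a b N
  assume a: "a \<in> carrier R" and b: "b \<in> carrier R" and N: "R_submodule R M N"
    and aRbRN: "set_smult M ((a <#\<^bsub>R\<^esub> carrier R) <#>\<^bsub>R\<^esub> (b <#\<^bsub>R\<^esub> carrier R)) N \<subseteq> P"
  note N_sub = subsetD[OF R_submodule_subset[OF N]]
  have step: "(\<forall>m\<in>carrier M. c \<odot>\<^bsub>M\<^esub> m \<in> P) \<or> x \<in> P"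
    if "c \<in> carrier R" "x \<in> carrier M" "\<And>r. r \<in> carrier R \<Longrightarrow> (c \<otimes>\<^bsub>R\<^esub> r) \<odot>\<^bsub>M\<^esub> x \<in> P" for c x
    using P that by (auto simp: prime_3_def l_coset_def set_smult_subset_iff)
  show "set_smult M {a} N \<subseteq> P \<or> set_smult M {b} N \<subseteq> P"
  proof (rule ccontr)
    assume contra: "\<not> ?thesis"
    have not_a: "\<not> (\<forall>m\<in>carrier M. a \<odot>\<^bsub>M\<^esub> m \<in> P)" and not_b: "\<not> (\<forall>m\<in>carrier M. b \<odot>\<^bsub>M\<^esub> m \<in> P)"
      using contra N_sub by (auto simp: set_smult_subset_iff)
    have bs: "(b \<otimes>\<^bsub>R\<^esub> s) \<odot>\<^bsub>M\<^esub> n \<in> P" if s: "s \<in> carrier R" and n: "n \<in> N" for s n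
    proof -
      note n_closed = N_sub[OF n]
      note bs_closed = mult_closed[OF b s]
      have "(a \<otimes>\<^bsub>R\<^esub> r) \<odot>\<^bsub>M\<^esub> ((b \<otimes>\<^bsub>R\<^esub> s) \<odot>\<^bsub>M\<^esub> n) \<in> P" if r: "r \<in> carrier R" for r
      proof -
        have "(a \<otimes>\<^bsub>R\<^esub> r) \<otimes>\<^bsub>R\<^esub> (b \<otimes>\<^bsub>R\<^esub> s) \<in> (a <#\<^bsub>R\<^esub> carrier R) <#>\<^bsub>R\<^esub> (b <#\<^bsub>R\<^esub> carrier R)"
          using r s by (auto simp: set_mult_def l_coset_def)
        then have "((a \<otimes>\<^bsub>R\<^esub> r) \<otimes>\<^bsub>R\<^esub> (b \<otimes>\<^bsub>R\<^esub> s)) \<odot>\<^bsub>M\<^esub> n \<in> P"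
          using aRbRN n by (auto simp: set_smult_subset_iff)
        then show ?thesis using smult_assoc[OF mult_closed[OF a r] bs_closed n_closed] by simp
      qed
      then show ?thesis using step[OF a smult_closed[OF bs_closed n_closed]] not_a by blast
    qed
    have "n \<in> P" if n: "n \<in> N" for n
      using step[OF b N_sub[OF n] bs[OF _ n]] not_b by blast
    then have "set_smult M {a} N \<subseteq> P"
      using R_ideal_smult_closed a proper by (auto simp: set_smult_subset_iff proper_R_ideal_def)
    then show False using contra by blast
  qed
qed

lemma (in near_ring_module) prime_c_imp_classical_prime_c:
  assumes P: "prime_c R M P"
  shows "classical_prime_c R M P"
  unfolding classical_prime_c_def
proof (intro conjI ballI allI impI)
  show proper: "proper_R_ideal R M P" using P by (simp add: prime_c_def)
  fix a b N
  assume a: "a \<in> carrier R" and b: "b \<in> carrier R" and N: "R_submodule R M N"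
    and aRbN: "set_smult M ((a <# carrier R) #> b) N \<subseteq> P"
  note N_sub = subsetD[OF R_submodule_subset[OF N]]
  have step: "(\<forall>m\<in>carrier M. c \<odot>\<^bsub>M\<^esub> m \<in> P) \<or> x \<in> P"
    if "c \<in> carrier R" "x \<in> carrier M" "c \<odot>\<^bsub>M\<^esub> x \<in> P" for c x
    using P that by (auto simp: prime_c_def set_smult_subset_iff)
  \<comment> \<open>One scalar that does not send \<open>M\<close> into \<open>P\<close> can be cancelled from every \<open>r(bn) \<in> P\<close>.\<close>
  obtain r where r: "r \<in> carrier R" "\<not> (\<forall>m\<in>carrier M. r \<odot>\<^bsub>M\<^esub> m \<in> P)"
    using proper by (auto simp: proper_R_ideal_def set_smult_subset_iff)
  show "set_smult M {a} N \<subseteq> P \<or> set_smult M {b} N \<subseteq> P"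
  proof (cases "\<forall>m\<in>carrier M. a \<odot>\<^bsub>M\<^esub> m \<in> P")
    case True
    then show ?thesis using N_sub by (auto simp: set_smult_subset_iff)
  next
    case False
    have "b \<odot>\<^bsub>M\<^esub> n \<in> P" if n: "n \<in> N" for n
    proof -
      note bn_closed = smult_closed[OF b N_sub[OF n]]
      have "(a \<otimes> r) \<otimes> b \<in> (a <# carrier R) #> b"
        using r by (auto simp: r_coset_def l_coset_def)
      then have "((a \<otimes> r) \<otimes> b) \<odot>\<^bsub>M\<^esub> n \<in> P"
        using aRbN n by (auto simp: set_smult_subset_iff)
      then have "a \<odot>\<^bsub>M\<^esub> (r \<odot>\<^bsub>M\<^esub> (b \<odot>\<^bsub>M\<^esub> n)) \<in> P"
        using smult_assoc mult_closed[OF a r(1)] a b r(1) N_sub[OF n] bn_closed by simp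
      then have "r \<odot>\<^bsub>M\<^esub> (b \<odot>\<^bsub>M\<^esub> n) \<in> P"
        using step[OF a smult_closed[OF r(1) bn_closed]] False by blast
      then show ?thesis using step[OF r(1) bn_closed] r(2) by blast
    qed
    then show ?thesis by (auto simp: set_smult_subset_iff)
  qed
qed

theorem proposition48:
  fixes R :: "('a, 'r) ring_scheme"
    and M :: "('a, 'b, 'm) module_scheme"
    and P :: "'b set"
  assumes "zero_symmetric_near_ring R"
    and "near_ring_module R M"
    and "faithful_module R M"
  shows "(prime_0 R M P \<longrightarrow> classical_prime_0 R M P) \<and>
    (prime_2 R M P \<longrightarrow> classical_prime_2 R M P) \<and>
    (prime_3 R M P \<longrightarrow> classical_prime_3 R M P) \<and>
    (prime_c R M P \<longrightarrow> classical_prime_c R M P)"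
proof -
  interpret zero_symmetric_module R M
    using assms(1,2) by (rule zero_symmetric_module.intro)
  show ?thesis
    using prime_0_imp_classical_prime_0 prime_2_imp_classical_prime_2
      prime_3_imp_classical_prime_3 prime_c_imp_classical_prime_c by blast
qed

end
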